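(* Let $n \geq 1$ be an integer, let $e_1, \ldots, e_n$ be the standard basis vectors of $\mathbb{R}^n$, and let $\Delta = \{x \in \mathbb{R}^n : x_1, \ldots, x_n \geq 0, \ \sum_{i=1}^n x_i = 1\} = \operatorname{conv}\{e_1, \ldots, e_n\}$ be the unit simplex. Then statement (KKM) implies statement (Sperner), where: (KKM) Whenever $C_1, \ldots, C_n$ are closed subsets of $\Delta$ such that for each nonempty $J \subseteq \{1, \ldots, n\}$ the set $\Delta_J := \operatorname{conv}\{e_j : j \in J\}$ is a subset of $\bigcup_{j \in J} C_j$, one has $\bigcap_{i=1}^n C_i \neq \emptyset$. (Sperner) For every simplicial subdivision of $\Delta$ and every Sperner labeling of it, the subdivision contains a completely labeled simplex.
   Context: An $m$-simplex in $\mathbb{R}^n$ is the convex hull $\operatorname{conv}\{a_1, \ldots, a_{m+1}\} = \{\sum_{i=1}^{m+1} \lambda_i a_i : \lambda_1, \ldots, \lambda_{m+1} \geq 0, \ \sum_i \lambda_i = 1\}$ of $m+1$ affinely independent vectors $a_1, \ldots, a_{m+1} \in \mathbb{R}^n$, called its vertices. Affine independence means that the only scalars with $\sum_{i=1}^{m+1} \lambda_i a_i = 0$ and $\sum_{i=1}^{m+1} \lambda_i = 0$ are $\lambda_1 = \cdots = \lambda_{m+1} = 0$. The vertices of a simplex are said to span it. A face of a simplex is a simplex spanned by a subset of its vertices; in particular a simplex is a face of itself. The unit simplex $\Delta \subseteq \mathbb{R}^n$ is an $(n-1)$-simplex with vertices $e_1, \ldots, e_n$. A (simplicial) subdivision of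 $\Delta$ is a finite collection of $(n-1)$-simplices whose union is $\Delta$ and such that the intersection of any two simplices in the collection is empty or a face of both. A Sperner labeling of a subdivision is a function $\ell$ assigning to each point $x$ that is a vertex of some simplex in the subdivision a label $\ell(x) \in \{1, \ldots, n\}$ such that $\ell(x) \in \{i : x_i > 0\}$. A simplex in the subdivision is completely labeled if its set of vertices has all $n$ distinct labels $1, \ldots, n$. *)

theory Defs
  imports "HOL-Analysis.Analysis"
begin

(* R^n is real ^ 'n, and the index and label set {1, ..., n} is the finite type 'n;
   n >= 1 since types are nonempty. *)

definition unit_simplex :: "(real ^ 'n) set" where
  "unit_simplex = {x. (\<forall>i. 0 \<le> x $ i) \<and> (\<Sum>i\<in>UNIV. x $ i) = 1}"

definition unit_simplex_face :: "'n set \<Rightarrow> (real ^ 'n) set" where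
  "unit_simplex_face J = convex hull ((\<lambda>j. axis j 1) ` J)"

(* A simplex has exactly one affinely independent spanning set, see
   simplex_vertices_convex_hull, so the union of all of them is its vertex set. *)
definition simplex_vertices :: "'a::euclidean_space set \<Rightarrow> 'a set" where
  "simplex_vertices S = \<Union> {V. \<not> affine_dependent V \<and> S = convex hull V}"

definition simplex_face_of :: "'a::euclidean_space set \<Rightarrow> 'a set \<Rightarrow> bool" where
  "simplex_face_of T S \<longleftrightarrow>
     (\<exists>W. W \<noteq> {} \<and> W \<subseteq> simplex_vertices S \<and> T = convex hull W)"

definition simplicial_subdivision :: "(real ^ 'n) set set \<Rightarrow> bool" where
  "simplicial_subdivision K \<longleftrightarrow>
     finite K \<and>
     (\<forall>S\<in>K. (int CARD('n) - 1) simplex S) \<and>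
     \<Union> K = unit_simplex \<and>
     (\<forall>S\<in>K. \<forall>T\<in>K. S \<inter> T = {} \<or>
        simplex_face_of (S \<inter> T) S \<and> simplex_face_of (S \<inter> T) T)"

(* The values of l at points that are not vertices of the subdivision are irrelevant. *)
definition sperner_labeling :: "(real ^ 'n) set set \<Rightarrow> (real ^ 'n \<Rightarrow> 'n) \<Rightarrow> bool" where
  "sperner_labeling K l \<longleftrightarrow> (\<forall>S\<in>K. \<forall>x\<in>simplex_vertices S. l x \<in> {i. x $ i > 0})"

definition completely_labeled :: "(real ^ 'n \<Rightarrow> 'n) \<Rightarrow> (real ^ 'n) set \<Rightarrow> bool" where
  "completely_labeled l S \<longleftrightarrow> l ` simplex_vertices S = UNIV"

lemma simplex_vertices_convex_hull:
  assumes "\<not> affine_dependent V"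
  shows "simplex_vertices (convex hull V) = V"
proof -
  have "W = V" if "\<not> affine_dependent W" "convex hull V = convex hull W" for W
    using extreme_point_of_convex_hull_affine_independent[OF assms]
      extreme_point_of_convex_hull_affine_independent[OF that(1)] that(2) by auto
  then show ?thesis
    unfolding simplex_vertices_def using assms by blast
qed

lemma unit_simplex_eq_face_UNIV: "unit_simplex = unit_simplex_face (UNIV :: 'n::finite set)"
proof -
  let ?e = "\<lambda>j::'n. axis j (1::real)"
  have inj: "inj ?e"
    by (auto simp: inj_def axis_eq_axis)
  have comp: "(\<Sum>j\<in>UNIV. c j *\<^sub>R ?e j) $ i = c i" for c :: "'n \<Rightarrow> real" and i
    by (simp add: axis_def if_distrib[of "\<lambda>x. _ * x"] cong: if_cong)
  have hull: "unit_simplex_face (UNIV :: 'n set) =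
      {y. \<exists>u. (\<forall>x\<in>range ?e. 0 \<le> u x) \<and> sum u (range ?e) = 1 \<and>
              (\<Sum>x\<in>range ?e. u x *\<^sub>R x) = y}"
    unfolding unit_simplex_face_def by (rule convex_hull_finite) simp
  show ?thesis
  proof (rule set_eqI)
    fix x :: "real ^ 'n"
    have "x \<in> unit_simplex_face UNIV \<longleftrightarrow>
        (\<exists>u. (\<forall>j. 0 \<le> u (?e j)) \<and> (\<Sum>j\<in>UNIV. u (?e j)) = 1 \<and> (\<forall>i. u (?e i) = x $ i))"
      unfolding hull by (simp add: sum.reindex[OF inj] vec_eq_iff comp o_def del: sum_component)
    also have "\<dots> \<longleftrightarrow> x \<in> unit_simplex"
    proof
      assume "x \<in> unit_simplex"
      then show "\<exists>u. (\<forall>j. 0 \<le> u (?e j)) \<and> (\<Sum>j\<in>UNIV. u (?e j)) = 1 \<and> (\<forall>i. u (?e i) = x $ i)"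
        by (intro exI[of _ "\<lambda>y. x $ (inv ?e y)"]) (simp add: inv_f_f[OF inj] unit_simplex_def)
    qed (auto simp: unit_simplex_def)
    finally show "x \<in> unit_simplex \<longleftrightarrow> x \<in> unit_simplex_face UNIV" ..
  qed
qed

end

theory Submission
  imports Defs
begin

text \<open>
  Fix a constant \<open>c\<close> with \<open>0 < c < 1\<close> and \<open>c \<le> 1 / n\<close>. Apply KKM to the sets \<open>C i\<close> of all points
  that have, in some simplex of the subdivision, barycentric coordinate at least \<open>c\<close> at a vertex
  with label \<open>i\<close>. Having coordinate at least \<open>c\<close> at the
  vertex \<open>v\<close> of a simplex \<open>S\<close> means lying in the copy \<open>c v + (1 - c) S\<close> of \<open>S\<close> shrunk towards
  \<open>v\<close>, so \<open>C i\<close> is a finite union of compact sets.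

  The sets cover as required. A point \<open>x\<close> of a simplex with \<open>n\<close> vertices has a coordinate of at
  least \<open>1 / n\<close>, at \<open>v\<close> say (\<open>convex_hull_shrunk_cover\<close>). If \<open>x\<close> is in the face of the unit
  simplex spanned by \<open>J\<close>, then so is \<open>v\<close>, as \<open>x\<close> gives it positive weight, and the Sperner
  condition puts the label of \<open>v\<close> into \<open>J\<close>.

  A common point \<open>x\<close> of the sets gives the completely labeled simplex: any simplex \<open>T\<close> of the
  subdivision that contains \<open>x\<close>. For each label \<open>i\<close>, the point \<open>x\<close> has positive weight at a vertex
  \<open>v\<close> with label \<open>i\<close> of some simplex \<open>S\<close>. As \<open>S\<close> and \<open>T\<close> meet in a common face containing \<open>x\<close>,
  this \<open>v\<close> is a vertex of \<open>T\<close> too (\<open>shrunk_point_vertex_shared\<close>).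
\<close>

definition shrunk_towards :: "real \<Rightarrow> 'a::real_vector \<Rightarrow> 'a set \<Rightarrow> 'a set" where
  "shrunk_towards c v S = (\<lambda>y. c *\<^sub>R v + (1 - c) *\<^sub>R y) ` S"

lemma compact_shrunk_towards:
  fixes S :: "'a::real_normed_vector set"
  assumes "compact S"
  shows "compact (shrunk_towards c v S)"
  unfolding shrunk_towards_def
  by (intro compact_continuous_image assms continuous_intros)

lemma shrunk_towards_subset:
  assumes "convex S" "v \<in> S" "0 \<le> c" "c \<le> 1"
  shows "shrunk_towards c v S \<subseteq> S"
  unfolding shrunk_towards_def using assms by (auto intro!: convexD)

text \<open>
  The weights of a convex combination of the points of \<open>V\<close> have average \<open>1 / card V\<close>, so one of
  them is at least \<open>c\<close>. Splitting \<open>c\<close> off that weight leaves a nonnegative combination of total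
  weight \<open>1 - c\<close>.
\<close>

lemma convex_hull_shrunk_cover:
  fixes V :: "'a::real_vector set" and c :: real
  assumes "finite V" "c < 1" "c * card V \<le> 1"
  shows "convex hull V \<subseteq> (\<Union>v\<in>V. shrunk_towards c v (convex hull V))"
proof
  fix x assume "x \<in> convex hull V"
  then obtain u where u: "\<And>w. w \<in> V \<Longrightarrow> 0 \<le> u w" "sum u V = 1" "(\<Sum>w\<in>V. u w *\<^sub>R w) = x"
    unfolding convex_hull_finite[OF assms(1)] by auto
  have "\<exists>v\<in>V. c \<le> u v"
  proof (rule ccontr)
    assume "\<not> ?thesis"
    moreover have "V \<noteq> {}" using u(2) by auto
    ultimately have "sum u V < (\<Sum>w\<in>V. c)"
      using assms(1) by (intro sum_strict_mono) auto
    then show False using u(2) assms(3) by (simp add: mult.commute)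
  qed
  then obtain v where v: "v \<in> V" "c \<le> u v" by blast
  define u' where "u' w = (u w - (if w = v then c else 0)) / (1 - c)" for w
  define y where "y = (\<Sum>w\<in>V. u' w *\<^sub>R w)"
  have "sum u' V = 1"
    using u(2) v(1) assms(1,2)
    by (simp add: u'_def sum_divide_distrib[symmetric] sum_subtractf)
  moreover have "0 \<le> u' w" if "w \<in> V" for w
    using u(1)[OF that] v(2) assms(2) by (simp add: u'_def)
  ultimately have "y \<in> convex hull V"
    unfolding convex_hull_finite[OF assms(1)] y_def by blast
  moreover have "(1 - c) *\<^sub>R y = (\<Sum>w\<in>V. u w *\<^sub>R w - (if w = v then c *\<^sub>R v else 0))"
    unfolding y_def scaleR_sum_right
  proof (intro sum.cong refl)
    fix w
    have "(1 - c) * u' w = u w - (if w = v then c else 0)"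
      using assms(2) by (simp add: u'_def)
    then show "(1 - c) *\<^sub>R u' w *\<^sub>R w = u w *\<^sub>R w - (if w = v then c *\<^sub>R v else 0)"
      by (simp add: scaleR_left_diff_distrib)
  qed
  then have "x = c *\<^sub>R v + (1 - c) *\<^sub>R y"
    using u(3) v(1) assms(1) by (simp add: sum_subtractf)
  ultimately show "x \<in> (\<Union>v\<in>V. shrunk_towards c v (convex hull V))"
    using v(1) unfolding shrunk_towards_def by blast
qed

text \<open>
  The point \<open>x\<close> is \<open>v\<close> itself or lies strictly between \<open>v\<close> and another point of \<open>S\<close>. Either way
  every face of \<open>S\<close> containing \<open>x\<close>, in particular \<open>S \<inter> T\<close>, contains \<open>v\<close>. Being extreme in \<open>S\<close>,
  the point \<open>v\<close> is extreme in \<open>S \<inter> T\<close>, hence one of the vertices of \<open>T\<close> that span \<open>S \<inter> T\<close>.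
\<close>

lemma shrunk_point_vertex_shared:
  fixes V :: "'a::euclidean_space set"
  assumes V: "\<not> affine_dependent V" "S = convex hull V" "v \<in> V"
    and faces: "simplex_face_of (S \<inter> T) S" "simplex_face_of (S \<inter> T) T"
    and c: "0 < c" "c < 1"
    and x: "x \<in> shrunk_towards c v S" "x \<in> T"
  shows "v \<in> simplex_vertices T"
proof -
  have vS: "v \<in> S" using V by (simp add: hull_inc)
  have xS: "x \<in> S"
    using x(1) shrunk_towards_subset[of S v c] vS c V(2) by auto
  obtain W where W: "W \<subseteq> simplex_vertices S" "S \<inter> T = convex hull W"
    using faces(1) unfolding simplex_face_of_def by blast
  have "W \<subseteq> V" using W(1) V by (simp add: simplex_vertices_convex_hull)
  then have face: "(S \<inter> T) face_of S"
    using face_of_convex_hull_affine_independent[OF V(1)] W(2) V(2) by auto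
  obtain y where y: "y \<in> S" "x = c *\<^sub>R v + (1 - c) *\<^sub>R y"
    using x(1) unfolding shrunk_towards_def by blast
  have vT: "v \<in> S \<inter> T"
  proof (cases "v = y")
    case True
    then have "x = v" using y(2) by (simp add: algebra_simps)
    then show ?thesis using vS x(2) by simp
  next
    case False
    then have "x \<in> open_segment v y"
      unfolding in_segment using y(2) c
      by (intro conjI exI[of _ "1 - c"]) (auto simp: algebra_simps)
    then show ?thesis using face_ofD[OF face] vS y(1) xS x(2) by blast
  qed
  have "v extreme_point_of S"
    using V extreme_point_of_convex_hull_affine_independent by blast
  then have ext: "v extreme_point_of (S \<inter> T)"
    using vT unfolding extreme_point_of_def by blast
  obtain W' where W': "W' \<subseteq> simplex_vertices T" "S \<inter> T = convex hull W'"
    using faces(2) unfolding simplex_face_of_def by blast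
  then show ?thesis
    using ext extreme_point_of_convex_hull by fastforce
qed

lemma unit_simplex_face_subset: "unit_simplex_face J \<subseteq> (unit_simplex :: (real ^ 'n::finite) set)"
  unfolding unit_simplex_eq_face_UNIV unfolding unit_simplex_face_def
  by (intro hull_mono) auto

lemma unit_simplex_face_component_zero:
  fixes x :: "real ^ 'n::finite"
  assumes "x \<in> unit_simplex_face J" "i \<notin> J"
  shows "x $ i = 0"
proof -
  have "convex hull ((\<lambda>j. axis j 1) ` J) \<subseteq> {x :: real ^ 'n. x $ i = 0}"
    using assms(2) by (intro hull_minimal) (auto simp: axis_def convex_def)
  then show ?thesis using assms(1) unfolding unit_simplex_face_def by blast
qed

theorem theorem1:
  assumes KKM: "\<forall>C :: 'n::finite \<Rightarrow> (real ^ 'n) set.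
      (\<forall>i. closed (C i) \<and> C i \<subseteq> unit_simplex) \<and>
      (\<forall>J. J \<noteq> {} \<longrightarrow> unit_simplex_face J \<subseteq> (\<Union>j\<in>J. C j))
      \<longrightarrow> (\<Inter>i. C i) \<noteq> {}"
  shows "\<forall>(K :: (real ^ 'n) set set) (l :: real ^ 'n \<Rightarrow> 'n).
      simplicial_subdivision K \<and> sperner_labeling K l
      \<longrightarrow> (\<exists>S\<in>K. completely_labeled l S)"
proof (intro allI impI, elim conjE)
  fix K :: "(real ^ 'n) set set" and l :: "real ^ 'n \<Rightarrow> 'n"
  assume K: "simplicial_subdivision K" and l: "sperner_labeling K l"
  have finK: "finite K" and UnK: "\<Union>K = unit_simplex"
    and faces: "\<And>S T. S \<in> K \<Longrightarrow> T \<in> K \<Longrightarrow> S \<inter> T \<noteq> {} \<Longrightarrow>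
        simplex_face_of (S \<inter> T) S \<and> simplex_face_of (S \<inter> T) T"
    using K unfolding simplicial_subdivision_def by blast+
  have vert: "\<not> affine_dependent (simplex_vertices S) \<and> card (simplex_vertices S) = CARD('n)
      \<and> convex hull (simplex_vertices S) = S" if S: "S \<in> K" for S
  proof -
    have "(int CARD('n) - 1) simplex S"
      using K S unfolding simplicial_subdivision_def by blast
    then obtain V where "\<not> affine_dependent V" "int (card V) = int CARD('n) - 1 + 1"
        "S = convex hull V"
      unfolding simplex_def by blast
    then show ?thesis by (simp add: simplex_vertices_convex_hull)
  qed
  have finV: "finite (simplex_vertices S)" if "S \<in> K" for S
    using vert[OF that] aff_independent_finite by blast
  have vS: "v \<in> S" if "S \<in> K" "v \<in> simplex_vertices S" for S v
    using vert[OF that(1)] hull_inc[OF that(2), of convex] by simp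
  have Sconv: "convex S" if "S \<in> K" for S
    using vert[OF that] convex_convex_hull[of "simplex_vertices S"] by simp
  have Scomp: "compact S" if "S \<in> K" for S
    using vert[OF that] finite_imp_compact_convex_hull[OF finV[OF that]] by simp
  \<comment> \<open>The simpler choice \<open>c = 1 / n\<close> violates \<open>c < 1\<close> for \<open>n = 1\<close>.\<close>
  define c where "c = 1 / (real CARD('n) + 1)"
  have c: "0 < c" "c < 1" "c * real CARD('n) \<le> 1"
    by (simp_all add: c_def divide_simps)
  define C where
    "C i = (\<Union>S\<in>K. \<Union>v\<in>{v\<in>simplex_vertices S. l v = i}. shrunk_towards c v S)" for i
  have shrunk: "shrunk_towards c v S \<subseteq> S" if "S \<in> K" "v \<in> simplex_vertices S" for S v
    using shrunk_towards_subset[OF Sconv vS] that c by simp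
  have "closed (C i)" for i
    unfolding C_def using finK finV Scomp
    by (intro compact_imp_closed compact_UN compact_shrunk_towards) auto
  moreover have Csub: "C i \<subseteq> unit_simplex" for i
    unfolding C_def UnK[symmetric] using shrunk by blast
  moreover have "unit_simplex_face J \<subseteq> (\<Union>j\<in>J. C j)" for J
  proof
    fix x :: "real ^ 'n" assume x: "x \<in> unit_simplex_face J"
    then obtain S where S: "S \<in> K" "x \<in> S"
      using unit_simplex_face_subset UnK by blast
    obtain v where v: "v \<in> simplex_vertices S" "x \<in> shrunk_towards c v S"
      using convex_hull_shrunk_cover[OF finV[OF S(1)] c(2)] vert[OF S(1)] c(3) S(2) by auto
    then obtain y where y: "y \<in> S" "x = c *\<^sub>R v + (1 - c) *\<^sub>R y"
      unfolding shrunk_towards_def by blast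
    have "v \<in> unit_simplex" "y \<in> unit_simplex"
      using vS[OF S(1) v(1)] y(1) S(1) UnK by auto
    then have nonneg: "0 \<le> v $ i" "0 \<le> y $ i" for i
      by (auto simp: unit_simplex_def)
    have pos: "0 < v $ l v"
      using l S(1) v(1) unfolding sperner_labeling_def by blast
    have "l v \<in> J"
    proof (rule ccontr)
      assume "l v \<notin> J"
      then have "c * v $ l v + (1 - c) * y $ l v = 0"
        using unit_simplex_face_component_zero[OF x] y(2) by simp
      moreover have "0 < c * v $ l v" "0 \<le> (1 - c) * y $ l v"
        using c pos nonneg by auto
      ultimately show False by linarith
    qed
    then show "x \<in> (\<Union>j\<in>J. C j)"
      unfolding C_def using S(1) v by blast
  qed
  ultimately have "(\<Inter>i. C i) \<noteq> {}" using KKM[rule_format, of C] by simp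
  then obtain x where x: "\<And>i. x \<in> C i" by blast
  then have "x \<in> unit_simplex" using Csub by blast
  then obtain T where T: "T \<in> K" "x \<in> T" using UnK by blast
  have "i \<in> l ` simplex_vertices T" for i
  proof -
    obtain S v where S: "S \<in> K" "v \<in> simplex_vertices S" "l v = i" "x \<in> shrunk_towards c v S"
      using x[of i] unfolding C_def by blast
    have "x \<in> S" using shrunk S by blast
    then have "simplex_face_of (S \<inter> T) S \<and> simplex_face_of (S \<inter> T) T"
      using faces S(1) T by blast
    then have "v \<in> simplex_vertices T"
      using shrunk_point_vertex_shared[of "simplex_vertices S" S v T c x] vert[OF S(1)] S T c
      by simp
    then show ?thesis using S(3) by blast
  qed
  then have "completely_labeled l T" unfolding completely_labeled_def by blast
  then show "\<exists>S\<in>K. completely_labeled l S" using T(1) by blast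
qed

end
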